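(* For any graph $G$ and any field $\mathbb{K}$ there exist a finite set $V'$ and abstract simplicial complexes $\Delta'\subset\Delta$ on $V'$ such that for all $k\in\mathbb{Z}_{>0}$ \[ \bar{\varphi}_G(k)=\mathcal{H}_{I_{\Delta/\Delta'}}(k). \]
   Context: A graph is a tuple $(V,E,\mathrm{head},\mathrm{tail})$ with finite vertex set $V$, finite edge set $E$ and maps $\mathrm{head},\mathrm{tail}:E\to V$ (loops and multiple edges allowed). A $\mathbb{Z}_k$-flow of $G$ is a map $f:E\to\mathbb{Z}_k$ such that for every vertex $v$, $\sum_{e:\mathrm{head}(e)=v}f_e-\sum_{e:\mathrm{tail}(e)=v}f_e=0$ in $\mathbb{Z}_k$; it is nowhere zero if $f_e\neq0$ for all $e$. $\bar{\varphi}_G(k)$ denotes the number of nowhere-zero $\mathbb{Z}_k$-flows of $G$ (the modular flow polynomial). For an abstract simplicial complex $\Delta$ on a finite set $V'$, identify $V'$ with the variables of $\mathbb{K}[x]=\mathbb{K}[x_v:v\in V']$ (standard grading). The Stanley–Reisner ideal is $I_\Delta=\langle x^u:\mathrm{supp}(u)\notin\Delta\rangle$, $\mathbb{K}[\Delta]=\mathbb{K}[x]/I_\Delta$, and for a subcomplex $\Delta'\subset\Delta$ the relative Stanley–Reisner ideal $I_{\Delta/\Delta'}$ is the ideal of $\mathbb{K}[\Delta]$ generated by the monomials $x^u$ with $\mathrm{supp}(u)\notin\Delta'$. Its Hilbert function $\mathcal{H}_{I_{\Delta/\Delta'}}(k)$ is the number of monomials $x^u$ of degree $k$ with $\mathrm{supp}(u)\in\Delta\setminus\Delta'$.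 *)

theory Defs
  imports
    "HOL-Number_Theory.Cong"
    "HOL-Library.FuncSet"
    "HOL-Library.Poly_Mapping"
    "HOL-Algebra.QuotRing"
    "HOL-Algebra.Embedded_Algebras"
    "Graph_Theory.Digraph"
begin

section \<open>Nowhere-zero flows modulo k\<close>

text \<open>
  Elements of the group of integers modulo \<open>k\<close> are represented by their least
  non-negative residues, and equations in that group by congruences.
\<close>

definition modular_flow :: "('v, 'e) pre_digraph \<Rightarrow> nat \<Rightarrow> ('e \<Rightarrow> int) \<Rightarrow> bool" where
  "modular_flow G k f \<longleftrightarrow>
     f \<in> arcs G \<rightarrow>\<^sub>E {0..<int k} \<and>
     (\<forall>v\<in>verts G. [(\<Sum>e\<in>in_arcs G v. f e) - (\<Sum>e\<in>out_arcs G v. f e) = 0] (mod int k))"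

definition nowhere_zero_on :: "'e set \<Rightarrow> ('e \<Rightarrow> int) \<Rightarrow> bool" where
  "nowhere_zero_on A f \<longleftrightarrow> (\<forall>e\<in>A. f e \<noteq> 0)"

definition modular_flow_count :: "('v, 'e) pre_digraph \<Rightarrow> nat \<Rightarrow> nat" where
  "modular_flow_count G k = card {f. modular_flow G k f \<and> nowhere_zero_on (arcs G) f}"


section \<open>Simplicial complexes and Stanley-Reisner ideals\<close>

text \<open>Complexes are non-void, i.e. contain the empty face; not every vertex need be a face.\<close>

definition simplicial_complex_on :: "'v set \<Rightarrow> 'v set set \<Rightarrow> bool" where
  "simplicial_complex_on V \<Delta> \<longleftrightarrow>
     \<Delta> \<noteq> {} \<and> \<Delta> \<subseteq> Pow V \<and> (\<forall>\<sigma>\<in>\<Delta>. \<forall>\<tau>. \<tau> \<subseteq> \<sigma> \<longrightarrow> \<tau> \<in> \<Delta>)"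

text \<open>
  An exponent vector is a finitely supported map \<open>'v \<Rightarrow>\<^sub>0 nat\<close>, its support is the set of
  its \<^const>\<open>Poly_Mapping.keys\<close>, and the monomial with exponent \<open>u\<close> is \<open>single u 1\<close>.
\<close>

definition exp_degree :: "('v \<Rightarrow>\<^sub>0 nat) \<Rightarrow> nat" where
  "exp_degree u = (\<Sum>v\<in>Poly_Mapping.keys u. Poly_Mapping.lookup u v)"

definition monomials_on :: "'v set \<Rightarrow> ('v \<Rightarrow>\<^sub>0 nat) set" where
  "monomials_on V = {u. Poly_Mapping.keys u \<subseteq> V}"

definition poly_ring_on :: "'v set \<Rightarrow> (('v \<Rightarrow>\<^sub>0 nat) \<Rightarrow>\<^sub>0 'k::field) ring" where
  "poly_ring_on V =
     \<lparr>carrier = {p. Poly_Mapping.keys p \<subseteq> monomials_on V},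
      mult = (*), one = 1, zero = 0, add = (+)\<rparr>"

definition stanley_reisner_ideal ::
    "'v set \<Rightarrow> 'v set set \<Rightarrow> (('v \<Rightarrow>\<^sub>0 nat) \<Rightarrow>\<^sub>0 'k::field) set" where
  "stanley_reisner_ideal V \<Delta> =
     Idl\<^bsub>poly_ring_on V\<^esub> {Poly_Mapping.single u 1 | u. u \<in> monomials_on V \<and> Poly_Mapping.keys u \<notin> \<Delta>}"

definition stanley_reisner_ring ::
    "'v set \<Rightarrow> 'v set set \<Rightarrow> (('v \<Rightarrow>\<^sub>0 nat) \<Rightarrow>\<^sub>0 'k::field) set ring" where
  "stanley_reisner_ring V \<Delta> = poly_ring_on V Quot stanley_reisner_ideal V \<Delta>"

definition residue_class ::
    "'v set \<Rightarrow> 'v set set \<Rightarrow> (('v \<Rightarrow>\<^sub>0 nat) \<Rightarrow>\<^sub>0 'k::field) \<Rightarrow> (('v \<Rightarrow>\<^sub>0 nat) \<Rightarrow>\<^sub>0 'k) set" where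
  "residue_class V \<Delta> p = stanley_reisner_ideal V \<Delta> +>\<^bsub>poly_ring_on V\<^esub> p"

definition relative_stanley_reisner_ideal ::
    "'v set \<Rightarrow> 'v set set \<Rightarrow> 'v set set \<Rightarrow> (('v \<Rightarrow>\<^sub>0 nat) \<Rightarrow>\<^sub>0 'k::field) set set" where
  "relative_stanley_reisner_ideal V \<Delta> \<Delta>' =
     Idl\<^bsub>stanley_reisner_ring V \<Delta>\<^esub>
       {residue_class V \<Delta> (Poly_Mapping.single u 1) | u.
          u \<in> monomials_on V \<and> Poly_Mapping.keys u \<notin> \<Delta>'}"

text \<open>
  The copy of the ground field inside the Stanley-Reisner ring; it is a subfield (lemma
  \<open>subfield_scalars\<close> below), so that dimensions over it are well defined.
\<close>

definition scalars ::
    "'v set \<Rightarrow> 'v set set \<Rightarrow> (('v \<Rightarrow>\<^sub>0 nat) \<Rightarrow>\<^sub>0 'k::field) set set" where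
  "scalars V \<Delta> = range (\<lambda>c. residue_class V \<Delta> (Poly_Mapping.single 0 c))"

definition graded_component ::
    "'v set \<Rightarrow> 'v set set \<Rightarrow> nat \<Rightarrow> (('v \<Rightarrow>\<^sub>0 nat) \<Rightarrow>\<^sub>0 'k::field) set set" where
  "graded_component V \<Delta> k =
     {residue_class V \<Delta> p | p.
        p \<in> carrier (poly_ring_on V) \<and> (\<forall>u\<in>Poly_Mapping.keys p. exp_degree u = k)}"

text \<open>
  The Hilbert function of a homogeneous ideal of the Stanley-Reisner ring: the dimension of its
  degree \<open>k\<close> part. For the relative Stanley-Reisner ideal this is the number of monomials of
  degree \<open>k\<close> whose support lies in \<open>\<Delta> - \<Delta>'\<close>
  (theorem \<open>hilbert_function_eq_card_monomials\<close> below).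
\<close>

definition hilbert_function ::
    "'v set \<Rightarrow> 'v set set \<Rightarrow> (('v \<Rightarrow>\<^sub>0 nat) \<Rightarrow>\<^sub>0 'k::field) set set \<Rightarrow> nat \<Rightarrow> nat" where
  "hilbert_function V \<Delta> J k =
     ring.dim (stanley_reisner_ring V \<Delta>) (scalars V \<Delta>) (J \<inter> graded_component V \<Delta> k)"


section \<open>The Hilbert function counts monomials\<close>

lemma poly_ring_on_simps [simp]:
  "carrier (poly_ring_on V) = {p. Poly_Mapping.keys p \<subseteq> monomials_on V}"
  "x \<otimes>\<^bsub>poly_ring_on V\<^esub> y = x * y"
  "x \<oplus>\<^bsub>poly_ring_on V\<^esub> y = x + y"
  "\<one>\<^bsub>poly_ring_on V\<^esub> = 1"
  "\<zero>\<^bsub>poly_ring_on V\<^esub> = 0"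
  by (simp_all add: poly_ring_on_def)

lemma keys_nat_add: "Poly_Mapping.keys (a + b) = Poly_Mapping.keys a \<union> Poly_Mapping.keys b"
  for a b :: "'v \<Rightarrow>\<^sub>0 nat"
  by (auto simp: in_keys_iff lookup_add)

lemma zero_in_monomials_on [simp]: "0 \<in> monomials_on V"
  by (simp add: monomials_on_def)

lemma monomials_on_add: "a \<in> monomials_on V \<Longrightarrow> b \<in> monomials_on V \<Longrightarrow> a + b \<in> monomials_on V"
  by (auto simp: monomials_on_def keys_nat_add)

lemma poly_ring_on_mult_closed:
  fixes p q :: "('v \<Rightarrow>\<^sub>0 nat) \<Rightarrow>\<^sub>0 'k::field"
  assumes "Poly_Mapping.keys p \<subseteq> monomials_on V" "Poly_Mapping.keys q \<subseteq> monomials_on V"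
  shows "Poly_Mapping.keys (p * q) \<subseteq> monomials_on V"
  using keys_mult[of p q] assms by (fastforce intro: monomials_on_add)

lemma cring_poly_ring_on: "cring (poly_ring_on V :: (('v \<Rightarrow>\<^sub>0 nat) \<Rightarrow>\<^sub>0 'k::field) ring)"
proof (rule cringI)
  let ?R = "poly_ring_on V :: (('v \<Rightarrow>\<^sub>0 nat) \<Rightarrow>\<^sub>0 'k) ring"
  show "abelian_group ?R"
  proof (rule abelian_groupI)
    fix x assume "x \<in> carrier ?R"
    then show "\<exists>y\<in>carrier ?R. y \<oplus>\<^bsub>?R\<^esub> x = \<zero>\<^bsub>?R\<^esub>"
      by (intro bexI[of _ "- x"]) (auto simp: in_keys_iff subset_iff)
  qed (use keys_add in \<open>fastforce simp: ac_simps\<close>)+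
  show "comm_monoid ?R"
    by (rule comm_monoidI)
       (use poly_ring_on_mult_closed in \<open>simp_all add: mult.assoc mult.commute zero_in_monomials_on\<close>)
qed (auto simp: algebra_simps)

definition polys_with :: "'v set \<Rightarrow> ('v set \<Rightarrow> bool) \<Rightarrow> (('v \<Rightarrow>\<^sub>0 nat) \<Rightarrow>\<^sub>0 'k::field) set" where
  "polys_with V P = {p. \<forall>u\<in>Poly_Mapping.keys p. u \<in> monomials_on V \<and> P (Poly_Mapping.keys u)}"

lemma ideal_polys_with:
  assumes up: "\<And>s t. P s \<Longrightarrow> P (s \<union> t)"
  shows "ideal (polys_with V P) (poly_ring_on V :: (('v \<Rightarrow>\<^sub>0 nat) \<Rightarrow>\<^sub>0 'k::field) ring)"
proof -
  let ?R = "poly_ring_on V :: (('v \<Rightarrow>\<^sub>0 nat) \<Rightarrow>\<^sub>0 'k) ring"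
  interpret cring ?R by (rule cring_poly_ring_on)
  have mult: "x * a \<in> polys_with V P"
    if "a \<in> polys_with V P" "x \<in> carrier ?R" for a x :: "('v \<Rightarrow>\<^sub>0 nat) \<Rightarrow>\<^sub>0 'k"
    unfolding polys_with_def
  proof (clarify, intro conjI)
    fix u assume "u \<in> Poly_Mapping.keys (x * a)"
    then obtain b c where "u = b + c" "b \<in> Poly_Mapping.keys x" "c \<in> Poly_Mapping.keys a"
      using keys_mult[of x a] by blast
    with that show "u \<in> monomials_on V" "P (Poly_Mapping.keys u)"
      using up[of "Poly_Mapping.keys c" "Poly_Mapping.keys b"]
      by (auto simp: polys_with_def keys_nat_add Un_commute intro!: monomials_on_add)
  qed
  have neg: "\<ominus>\<^bsub>?R\<^esub> a = - a" if "a \<in> carrier ?R" for a :: "('v \<Rightarrow>\<^sub>0 nat) \<Rightarrow>\<^sub>0 'k"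
    using that by (intro minus_equality) (auto simp: in_keys_iff subset_iff)
  show ?thesis
  proof (rule idealI)
    show "ring ?R" by (rule ring_axioms)
    show "subgroup (polys_with V P) (add_monoid ?R)"
    proof (rule add.subgroupI)
      fix a :: "('v \<Rightarrow>\<^sub>0 nat) \<Rightarrow>\<^sub>0 'k" assume a: "a \<in> polys_with V P"
      then have "\<ominus>\<^bsub>?R\<^esub> a = - a" by (intro neg) (auto simp: polys_with_def)
      with a show "\<ominus>\<^bsub>?R\<^esub> a \<in> polys_with V P" by (auto simp: polys_with_def in_keys_iff)
    next
      show "polys_with V P \<noteq> ({} :: (('v \<Rightarrow>\<^sub>0 nat) \<Rightarrow>\<^sub>0 'k) set)"
        by (auto simp: polys_with_def intro!: exI[of _ 0])
    next
      fix a b :: "('v \<Rightarrow>\<^sub>0 nat) \<Rightarrow>\<^sub>0 'k" assume "a \<in> polys_with V P" "b \<in> polys_with V P"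
      then show "a \<oplus>\<^bsub>?R\<^esub> b \<in> polys_with V P"
        using keys_add[of a b] by (auto simp: polys_with_def)
    qed (auto simp: polys_with_def)
  qed (use mult in \<open>auto simp: mult.commute\<close>)
qed

lemma poly_sum_single:
  fixes p :: "('v \<Rightarrow>\<^sub>0 nat) \<Rightarrow>\<^sub>0 'k::field"
  shows "p = (\<Sum>u\<in>Poly_Mapping.keys p. Poly_Mapping.single u (Poly_Mapping.lookup p u))"
  by (rule poly_mapping_eqI) (auto simp: lookup_sum lookup_single when_def in_keys_iff)

lemma single_eq_const_mult:
  "Poly_Mapping.single u c = Poly_Mapping.single 0 c * Poly_Mapping.single u 1"
  for c :: "'k::field" and u :: "'v \<Rightarrow>\<^sub>0 nat"
  by (simp add: mult_single)

lemma polys_with_subset_ideal: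
  fixes J :: "(('v \<Rightarrow>\<^sub>0 nat) \<Rightarrow>\<^sub>0 'k::field) set"
  assumes "ideal J (poly_ring_on V)"
    and gens: "\<And>u. u \<in> monomials_on V \<Longrightarrow> P (Poly_Mapping.keys u) \<Longrightarrow> Poly_Mapping.single u 1 \<in> J"
  shows "polys_with V P \<subseteq> J"
proof
  interpret ideal J "poly_ring_on V" by fact
  have add: "a + b \<in> J" if "a \<in> J" "b \<in> J" for a b using additive_subgroup.a_closed[OF additive_subgroup_axioms that] by simp
  have zero: "0 \<in> J" using additive_subgroup.zero_closed[OF additive_subgroup_axioms] by simp
  fix p :: "('v \<Rightarrow>\<^sub>0 nat) \<Rightarrow>\<^sub>0 'k" assume p: "p \<in> polys_with V P"
  have "(\<Sum>u\<in>A. Poly_Mapping.single u (Poly_Mapping.lookup p u)) \<in> J"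
    if "finite A" "A \<subseteq> Poly_Mapping.keys p" for A
    using that
  proof (induction A)
    case empty
    show ?case by (simp add: zero)
  next
    case (insert u A)
    have "Poly_Mapping.single u 1 \<in> J"
      using p insert.prems by (intro gens) (auto simp: polys_with_def)
    then have "Poly_Mapping.single 0 (Poly_Mapping.lookup p u) * Poly_Mapping.single u 1 \<in> J"
      using I_l_closed[of "Poly_Mapping.single u 1" "Poly_Mapping.single 0 (Poly_Mapping.lookup p u)"]
      by (simp add: monomials_on_def)
    with insert show ?case by (auto intro!: add simp: single_eq_const_mult[symmetric])
  qed
  from this[of "Poly_Mapping.keys p"] show "p \<in> J" by (simp flip: poly_sum_single)
qed

lemma stanley_reisner_ideal_eq:
  assumes "simplicial_complex_on V \<Delta>"
  shows "stanley_reisner_ideal V \<Delta> =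
    (polys_with V (\<lambda>s. s \<notin> \<Delta>) :: (('v \<Rightarrow>\<^sub>0 nat) \<Rightarrow>\<^sub>0 'k::field) set)"
proof -
  interpret cring "poly_ring_on V :: (('v \<Rightarrow>\<^sub>0 nat) \<Rightarrow>\<^sub>0 'k) ring" by (rule cring_poly_ring_on)
  let ?S = "{Poly_Mapping.single u 1 | u. u \<in> monomials_on V \<and> Poly_Mapping.keys u \<notin> \<Delta>}
    :: (('v \<Rightarrow>\<^sub>0 nat) \<Rightarrow>\<^sub>0 'k) set"
  have S: "?S \<subseteq> carrier (poly_ring_on V)" by auto
  show ?thesis
  proof
    show "stanley_reisner_ideal V \<Delta> \<subseteq> (polys_with V (\<lambda>s. s \<notin> \<Delta>) :: (_ \<Rightarrow>\<^sub>0 'k) set)"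
      unfolding stanley_reisner_ideal_def
      using assms by (intro genideal_minimal ideal_polys_with)
        (auto simp: polys_with_def simplicial_complex_on_def)
    show "polys_with V (\<lambda>s. s \<notin> \<Delta>) \<subseteq> (stanley_reisner_ideal V \<Delta> :: (_ \<Rightarrow>\<^sub>0 'k) set)"
      unfolding stanley_reisner_ideal_def
      using genideal_self[OF S]
      by (intro polys_with_subset_ideal genideal_ideal[OF S]) blast
  qed
qed

lemma ideal_stanley_reisner_ideal:
  assumes "simplicial_complex_on V \<Delta>"
  shows "ideal (stanley_reisner_ideal V \<Delta>) (poly_ring_on V :: (('v \<Rightarrow>\<^sub>0 nat) \<Rightarrow>\<^sub>0 'k::field) ring)"
  unfolding stanley_reisner_ideal_eq[OF assms]
  using assms by (intro ideal_polys_with) (auto simp: simplicial_complex_on_def)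

lemma ring_hom_residue_class:
  assumes "simplicial_complex_on V \<Delta>"
  shows "ring_hom_ring (poly_ring_on V :: (('v \<Rightarrow>\<^sub>0 nat) \<Rightarrow>\<^sub>0 'k::field) ring)
    (stanley_reisner_ring V \<Delta>) (residue_class V \<Delta>)"
proof -
  have "residue_class V \<Delta> = (+>\<^bsub>poly_ring_on V :: (('v \<Rightarrow>\<^sub>0 nat) \<Rightarrow>\<^sub>0 'k) ring\<^esub>) (stanley_reisner_ideal V \<Delta>)"
    by (auto simp: residue_class_def)
  then show ?thesis
    using ideal.rcos_ring_hom_ring[OF ideal_stanley_reisner_ideal[OF assms]]
    by (simp add: stanley_reisner_ring_def)
qed

lemma carrier_stanley_reisner_ring:
  "carrier (stanley_reisner_ring V \<Delta>) =
    residue_class V \<Delta> ` carrier (poly_ring_on V :: (('v \<Rightarrow>\<^sub>0 nat) \<Rightarrow>\<^sub>0 'k::field) ring)"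
  unfolding stanley_reisner_ring_def FactRing_def A_RCOSETS_def' residue_class_def by auto

lemma residue_class_eq_iff:
  fixes p q :: "('v \<Rightarrow>\<^sub>0 nat) \<Rightarrow>\<^sub>0 'k::field"
  assumes "simplicial_complex_on V \<Delta>" "p \<in> carrier (poly_ring_on V)" "q \<in> carrier (poly_ring_on V)"
  shows "residue_class V \<Delta> p = residue_class V \<Delta> q \<longleftrightarrow> p - q \<in> polys_with V (\<lambda>s. s \<notin> \<Delta>)"
proof -
  let ?R = "poly_ring_on V :: (('v \<Rightarrow>\<^sub>0 nat) \<Rightarrow>\<^sub>0 'k) ring"
  interpret cring ?R by (rule cring_poly_ring_on)
  have "\<ominus>\<^bsub>?R\<^esub> q = - q"
    using assms(3) by (intro minus_equality) (auto simp: in_keys_iff subset_iff)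
  then have "p \<ominus>\<^bsub>?R\<^esub> q = p - q" by (simp add: a_minus_def)
  then show ?thesis
    using quotient_eq_iff_same_a_r_cos[OF ideal_stanley_reisner_ideal[OF assms(1)] assms(2,3)]
    by (simp add: residue_class_def stanley_reisner_ideal_eq[OF assms(1)])
qed
lemma relative_stanley_reisner_ideal_eq:
  assumes \<Delta>: "simplicial_complex_on V \<Delta>" and \<Delta>': "simplicial_complex_on V \<Delta>'"
  shows "relative_stanley_reisner_ideal V \<Delta> \<Delta>' =
    residue_class V \<Delta> ` (polys_with V (\<lambda>s. s \<notin> \<Delta>') :: (('v \<Rightarrow>\<^sub>0 nat) \<Rightarrow>\<^sub>0 'k::field) set)"
proof -
  let ?R = "poly_ring_on V :: (('v \<Rightarrow>\<^sub>0 nat) \<Rightarrow>\<^sub>0 'k) ring"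
  let ?S = "stanley_reisner_ring V \<Delta> :: (('v \<Rightarrow>\<^sub>0 nat) \<Rightarrow>\<^sub>0 'k) set ring"
  let ?h = "residue_class V \<Delta> :: (('v \<Rightarrow>\<^sub>0 nat) \<Rightarrow>\<^sub>0 'k) \<Rightarrow> _"
  let ?P = "polys_with V (\<lambda>s. s \<notin> \<Delta>') :: (('v \<Rightarrow>\<^sub>0 nat) \<Rightarrow>\<^sub>0 'k) set"
  let ?G = "{?h (Poly_Mapping.single u 1) | u. u \<in> monomials_on V \<and> Poly_Mapping.keys u \<notin> \<Delta>'}"
  interpret h: ring_hom_ring ?R ?S ?h by (rule ring_hom_residue_class[OF \<Delta>])
  have P: "ideal ?P ?R"
    using \<Delta>' by (intro ideal_polys_with) (auto simp: simplicial_complex_on_def)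
  interpret P: ideal ?P ?R by fact
  have G: "?G \<subseteq> carrier ?S"
    unfolding carrier_stanley_reisner_ring by auto
  have img: "ideal (?h ` ?P) ?S"
  proof (rule idealI)
    show "ring ?S" by (rule h.S.ring_axioms)
    show "subgroup (?h ` ?P) (add_monoid ?S)"
      using h.img_is_add_subgroup[OF P.a_subgroup] .
  next
    fix a x assume "a \<in> ?h ` ?P" "x \<in> carrier ?S"
    then obtain b y where b: "b \<in> ?P" "a = ?h b" and y: "y \<in> carrier ?R" "x = ?h y"
      unfolding carrier_stanley_reisner_ring by blast
    have bR: "b \<in> carrier ?R" using b P.a_subset by blast
    have "x \<otimes>\<^bsub>?S\<^esub> a = ?h (y \<otimes>\<^bsub>?R\<^esub> b)" "a \<otimes>\<^bsub>?S\<^esub> x = ?h (b \<otimes>\<^bsub>?R\<^esub> y)"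
      using h.hom_mult[OF y(1) bR] h.hom_mult[OF bR y(1)] b(2) y(2) by metis+
    then show "x \<otimes>\<^bsub>?S\<^esub> a \<in> ?h ` ?P" "a \<otimes>\<^bsub>?S\<^esub> x \<in> ?h ` ?P"
      using P.I_l_closed[OF b(1) y(1)] P.I_r_closed[OF b(1) y(1)] by blast+
  qed
  show ?thesis
  proof
    show "relative_stanley_reisner_ideal V \<Delta> \<Delta>' \<subseteq> ?h ` ?P"
      unfolding relative_stanley_reisner_ideal_def
      by (rule h.S.genideal_minimal[OF img]) (auto simp: polys_with_def)
    have "ideal {r \<in> carrier ?R. ?h r \<in> Idl\<^bsub>?S\<^esub> ?G} ?R"
      by (rule h.ideal_vimage[OF h.S.genideal_ideal[OF G]])
    then have "?P \<subseteq> {r \<in> carrier ?R. ?h r \<in> Idl\<^bsub>?S\<^esub> ?G}"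
      using h.S.genideal_self[OF G] by (intro polys_with_subset_ideal) auto
    then show "?h ` ?P \<subseteq> relative_stanley_reisner_ideal V \<Delta> \<Delta>'"
      unfolding relative_stanley_reisner_ideal_def by blast
  qed
qed

lemma relative_graded_component_eq:
  assumes \<Delta>: "simplicial_complex_on V \<Delta>" and \<Delta>': "simplicial_complex_on V \<Delta>'"
  shows "relative_stanley_reisner_ideal V \<Delta> \<Delta>' \<inter> graded_component V \<Delta> k =
    residue_class V \<Delta> ` {p :: ('v \<Rightarrow>\<^sub>0 nat) \<Rightarrow>\<^sub>0 'k::field. Poly_Mapping.keys p \<subseteq>
      {u \<in> monomials_on V. exp_degree u = k \<and> Poly_Mapping.keys u \<in> \<Delta> - \<Delta>'}}"
    (is "?L = ?h ` ?M")
proof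
  show "?h ` ?M \<subseteq> ?L"
    unfolding relative_stanley_reisner_ideal_eq[OF assms] graded_component_def
    by (auto simp: polys_with_def subset_iff)
  show "?L \<subseteq> ?h ` ?M"
  proof
    fix c :: "(('v \<Rightarrow>\<^sub>0 nat) \<Rightarrow>\<^sub>0 'k) set" assume "c \<in> ?L"
    then obtain p q where p: "p \<in> polys_with V (\<lambda>s. s \<notin> \<Delta>')" "c = ?h p"
      and q: "Poly_Mapping.keys q \<subseteq> monomials_on V" "\<forall>u\<in>Poly_Mapping.keys q. exp_degree u = k" "c = ?h q"
      unfolding relative_stanley_reisner_ideal_eq[OF assms] graded_component_def by auto
    from p(1) have pR: "Poly_Mapping.keys p \<subseteq> monomials_on V" by (auto simp: polys_with_def)
    have pq: "p - q \<in> polys_with V (\<lambda>s. s \<notin> \<Delta>)"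
      using residue_class_eq_iff[OF \<Delta>, of p q] p q pR by simp
    define r where "r = (\<Sum>u\<in>{u\<in>Poly_Mapping.keys q. Poly_Mapping.keys u \<in> \<Delta>}.
                           Poly_Mapping.single u (Poly_Mapping.lookup q u))"
    have r: "Poly_Mapping.lookup r u =
        (if Poly_Mapping.keys u \<in> \<Delta> then Poly_Mapping.lookup q u else 0)" for u
      by (auto simp: r_def lookup_sum lookup_single when_def in_keys_iff)
    have rR: "Poly_Mapping.keys r \<subseteq> monomials_on V"
      using q(1) by (auto simp: in_keys_iff r split: if_splits)
    have "q - r \<in> polys_with V (\<lambda>s. s \<notin> \<Delta>)"
      using q(1) by (auto simp: polys_with_def in_keys_iff lookup_minus r split: if_splits)
    then have "c = ?h r"
      using residue_class_eq_iff[OF \<Delta>, of q r] q rR by simp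
    moreover have "r \<in> ?M"
    proof (clarify, intro conjI CollectI)
      fix u assume u: "u \<in> Poly_Mapping.keys r"
      then have uq: "u \<in> Poly_Mapping.keys q" and u\<Delta>: "Poly_Mapping.keys u \<in> \<Delta>"
        by (auto simp: in_keys_iff r split: if_splits)
      then show "u \<in> monomials_on V" "exp_degree u = k" using q by auto
      have "u \<notin> Poly_Mapping.keys (p - q)" using pq u\<Delta> by (auto simp: polys_with_def)
      with uq have "u \<in> Poly_Mapping.keys p" by (auto simp: in_keys_iff lookup_minus)
      with p(1) u\<Delta> show "Poly_Mapping.keys u \<in> \<Delta> - \<Delta>'" by (auto simp: polys_with_def)
    qed
    ultimately show "c \<in> ?h ` ?M" by blast
  qed
qed

lemma subfield_scalars:
  assumes \<Delta>: "simplicial_complex_on V \<Delta>"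
  shows "subfield (scalars V \<Delta>) (stanley_reisner_ring V \<Delta> :: (('v \<Rightarrow>\<^sub>0 nat) \<Rightarrow>\<^sub>0 'k::field) set ring)"
proof -
  let ?R = "poly_ring_on V :: (('v \<Rightarrow>\<^sub>0 nat) \<Rightarrow>\<^sub>0 'k) ring"
  let ?S = "stanley_reisner_ring V \<Delta> :: (('v \<Rightarrow>\<^sub>0 nat) \<Rightarrow>\<^sub>0 'k) set ring"
  let ?h = "residue_class V \<Delta> :: (('v \<Rightarrow>\<^sub>0 nat) \<Rightarrow>\<^sub>0 'k) \<Rightarrow> _"
  let ?K = "range (Poly_Mapping.single 0) :: (('v \<Rightarrow>\<^sub>0 nat) \<Rightarrow>\<^sub>0 'k) set"
  interpret h: ring_hom_ring ?R ?S ?h by (rule ring_hom_residue_class[OF \<Delta>])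
  have uminus: "\<ominus>\<^bsub>?R\<^esub> a = - a" if "a \<in> carrier ?R" for a
    using that by (intro h.R.minus_equality) (auto simp: in_keys_iff subset_iff)
  have K: "subfield ?K ?R"
  proof (rule h.R.subfieldI)
    show "subcring ?K ?R"
    proof (intro h.R.subcringI h.R.subringI)
      fix a assume "a \<in> ?K"
      then obtain c where c: "a = Poly_Mapping.single 0 c" by blast
      then have "\<ominus>\<^bsub>?R\<^esub> a = Poly_Mapping.single 0 (- c)"
        by (subst uminus) (auto simp: single_uminus)
      then show "\<ominus>\<^bsub>?R\<^esub> a \<in> ?K" by blast
    qed (auto simp: mult_single mult.commute single_add[symmetric] simp flip: single_one split: if_splits)
    show "Units (?R\<lparr>carrier := ?K\<rparr>) = ?K - {\<zero>\<^bsub>?R\<^esub>}"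
    proof
      show "Units (?R\<lparr>carrier := ?K\<rparr>) \<subseteq> ?K - {\<zero>\<^bsub>?R\<^esub>}"
        by (auto simp: Units_def)
      show "?K - {\<zero>\<^bsub>?R\<^esub>} \<subseteq> Units (?R\<lparr>carrier := ?K\<rparr>)"
      proof
        fix a assume "a \<in> ?K - {\<zero>\<^bsub>?R\<^esub>}"
        then obtain c where c: "a = Poly_Mapping.single 0 c" "a \<noteq> 0" by auto
        then have "c \<noteq> 0" by auto
        with c(1) have "Poly_Mapping.single 0 (inverse c) * a = 1" "a * Poly_Mapping.single 0 (inverse c) = 1"
          by (simp_all add: mult_single)
        with c show "a \<in> Units (?R\<lparr>carrier := ?K\<rparr>)"
          unfolding Units_def by auto
      qed
    qed
  qed
  have "?h 1 \<noteq> ?h 0"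
    using \<Delta> residue_class_eq_iff[OF \<Delta>, of "1 :: ('v \<Rightarrow>\<^sub>0 nat) \<Rightarrow>\<^sub>0 'k" 0]
    by (auto simp: polys_with_def simplicial_complex_on_def)
  then have "\<one>\<^bsub>?S\<^esub> \<noteq> \<zero>\<^bsub>?S\<^esub>"
    using h.hom_one h.hom_zero by simp
  from h.img_is_subfield(2)[OF K this] show ?thesis
    by (simp add: scalars_def image_image)
qed

lemma monomials_independent:
  fixes V :: "'v set"
  assumes \<Delta>: "simplicial_complex_on V \<Delta>"
    and "distinct us" "set us \<subseteq> {u \<in> monomials_on V. Poly_Mapping.keys u \<in> \<Delta>}"
  defines "S \<equiv> stanley_reisner_ring V \<Delta> :: (('v \<Rightarrow>\<^sub>0 nat) \<Rightarrow>\<^sub>0 'k::field) set ring"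
    and "ms \<equiv> map (\<lambda>u. residue_class V \<Delta> (Poly_Mapping.single u 1)) us"
  shows "ring.independent S (scalars V \<Delta>) ms \<and>
    ring.Span S (scalars V \<Delta>) ms = residue_class V \<Delta> ` {p. Poly_Mapping.keys p \<subseteq> set us}"
proof -
  let ?R = "poly_ring_on V :: (('v \<Rightarrow>\<^sub>0 nat) \<Rightarrow>\<^sub>0 'k) ring"
  let ?h = "residue_class V \<Delta> :: (('v \<Rightarrow>\<^sub>0 nat) \<Rightarrow>\<^sub>0 'k) \<Rightarrow> _"
  let ?m = "\<lambda>u. ?h (Poly_Mapping.single u 1)"
  interpret h: ring_hom_ring ?R S ?h unfolding S_def by (rule ring_hom_residue_class[OF \<Delta>])
  show ?thesis
    using assms(2,3) unfolding ms_def
  proof (induction us)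
    case Nil
    have "{p :: ('v \<Rightarrow>\<^sub>0 nat) \<Rightarrow>\<^sub>0 'k. Poly_Mapping.keys p \<subseteq> {}} = {0}"
      by (auto intro: poly_mapping_eqI simp: in_keys_iff)
    with h.hom_zero show ?case by simp
  next
    case (Cons u us)
    let ?E = "?h ` {p. Poly_Mapping.keys p \<subseteq> set us}"
    have ind: "h.S.independent (scalars V \<Delta>) (map ?m us)"
      and span: "h.S.Span (scalars V \<Delta>) (map ?m us) = ?E"
      using Cons by simp_all
    have u: "u \<in> monomials_on V" "Poly_Mapping.keys u \<in> \<Delta>" "u \<notin> set us"
      and us: "set us \<subseteq> monomials_on V"
      using Cons.prems by auto
    have comb: "?h (Poly_Mapping.single 0 c) \<otimes>\<^bsub>S\<^esub> ?m u \<oplus>\<^bsub>S\<^esub> ?h q = ?h (Poly_Mapping.single u c + q)"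
      if "Poly_Mapping.keys q \<subseteq> set us" for c q
    proof -
      have *: "Poly_Mapping.single 0 c \<in> carrier ?R" "Poly_Mapping.single u 1 \<in> carrier ?R"
        "q \<in> carrier ?R" "Poly_Mapping.single u c \<in> carrier ?R"
        using that u us by auto
      show ?thesis
        using h.hom_mult[OF *(1,2)] h.hom_add[OF *(4,3)] by (simp add: mult_single)
    qed
    have notin: "?m u \<notin> ?E"
    proof
      assume "?m u \<in> ?E"
      then obtain q where q: "Poly_Mapping.keys q \<subseteq> set us" "?m u = ?h q" by blast
      then have "Poly_Mapping.single u 1 - q \<in> polys_with V (\<lambda>s. s \<notin> \<Delta>)"
        using residue_class_eq_iff[OF \<Delta>, of "Poly_Mapping.single u 1" q] u us by auto
      moreover have "u \<in> Poly_Mapping.keys (Poly_Mapping.single u 1 - q)"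
      proof -
        have "u \<notin> Poly_Mapping.keys q" using q(1) u(3) by blast
        then have "Poly_Mapping.lookup q u = 0" by (simp add: in_keys_iff)
        then show ?thesis by (simp add: in_keys_iff lookup_minus)
      qed
      ultimately show False using u by (auto simp: polys_with_def)
    qed
    have "h.S.Span (scalars V \<Delta>) (map ?m (u # us)) =
        h.S.line_extension (scalars V \<Delta>) (?m u) ?E"
      using span by simp
    also have "\<dots> = ?h ` {p. Poly_Mapping.keys p \<subseteq> set (u # us)}"
    proof (intro subset_antisym subsetI)
      fix x assume "x \<in> h.S.line_extension (scalars V \<Delta>) (?m u) ?E"
      then obtain c q where cq: "Poly_Mapping.keys q \<subseteq> set us"
        "x = ?h (Poly_Mapping.single 0 c) \<otimes>\<^bsub>S\<^esub> ?m u \<oplus>\<^bsub>S\<^esub> ?h q"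
        by (auto simp: h.S.line_extension_mem_iff scalars_def)
      have "Poly_Mapping.keys (Poly_Mapping.single u c + q) \<subseteq> set (u # us)"
        using keys_add[of "Poly_Mapping.single u c" q] cq(1) by (auto split: if_splits)
      with cq comb show "x \<in> ?h ` {p. Poly_Mapping.keys p \<subseteq> set (u # us)}" by auto
    next
      fix x assume "x \<in> ?h ` {p. Poly_Mapping.keys p \<subseteq> set (u # us)}"
      then obtain p where p: "Poly_Mapping.keys p \<subseteq> set (u # us)" "x = ?h p" by blast
      define q where "q = p - Poly_Mapping.single u (Poly_Mapping.lookup p u)"
      have q: "Poly_Mapping.keys q \<subseteq> set us"
      proof
        fix w assume "w \<in> Poly_Mapping.keys q"
        then have "w \<noteq> u" "w \<in> Poly_Mapping.keys p"
          by (auto simp: q_def in_keys_iff lookup_minus lookup_single when_def split: if_splits)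
        with p(1) show "w \<in> set us" by auto
      qed
      have "x = ?h (Poly_Mapping.single u (Poly_Mapping.lookup p u) + q)"
        by (simp add: p(2) q_def)
      with comb[OF q] q show "x \<in> h.S.line_extension (scalars V \<Delta>) (?m u) ?E"
        by (auto simp: h.S.line_extension_mem_iff scalars_def)
    qed
    finally have "h.S.Span (scalars V \<Delta>) (map ?m (u # us)) =
      ?h ` {p. Poly_Mapping.keys p \<subseteq> set (u # us)}" .
    moreover have "h.S.independent (scalars V \<Delta>) (map ?m (u # us))"
      using ind span notin u by (auto intro!: h.S.independent.li_Cons h.hom_closed)
    ultimately show ?case by blast
  qed
qed

lemma finite_monomials_of_degree:
  assumes "finite V"
  shows "finite {u \<in> monomials_on V. exp_degree u = k}"
proof -
  let ?M = "{u \<in> monomials_on V. exp_degree u = k}"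
  have "finite (Poly_Mapping.lookup ` ?M)"
  proof (rule finite_subset)
    show "Poly_Mapping.lookup ` ?M \<subseteq> {f. \<forall>v. (v \<in> V \<longrightarrow> f v \<in> {..k}) \<and> (v \<notin> V \<longrightarrow> f v = 0)}"
    proof clarsimp
      fix u v assume u: "u \<in> monomials_on V" "k = exp_degree u"
      have "Poly_Mapping.lookup u v \<le> exp_degree u"
      proof (cases "v \<in> Poly_Mapping.keys u")
        case True
        then show ?thesis unfolding exp_degree_def by (intro member_le_sum) simp_all
      qed (simp add: in_keys_iff)
      with u show "(v \<in> V \<longrightarrow> Poly_Mapping.lookup u v \<le> exp_degree u) \<and>
          (v \<notin> V \<longrightarrow> Poly_Mapping.lookup u v = 0)"
        by (auto simp: monomials_on_def in_keys_iff)
    qed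
    show "finite {f. \<forall>v. (v \<in> V \<longrightarrow> f v \<in> {..k}) \<and> (v \<notin> V \<longrightarrow> f v = 0)}"
      using finite_set_of_finite_funs[OF assms, of "{..k}" 0] by simp
  qed
  then show ?thesis
    by (rule finite_imageD) (simp add: inj_on_def flip: poly_mapping_eq_iff)
qed

theorem hilbert_function_eq_card_monomials:
  fixes V :: "'v set"
  assumes V: "finite V" and \<Delta>: "simplicial_complex_on V \<Delta>" and \<Delta>': "simplicial_complex_on V \<Delta>'"
  shows "hilbert_function V \<Delta>
      (relative_stanley_reisner_ideal V \<Delta> \<Delta>' :: (('v \<Rightarrow>\<^sub>0 nat) \<Rightarrow>\<^sub>0 'k::field) set set) k =
    card {u \<in> monomials_on V. exp_degree u = k \<and> Poly_Mapping.keys u \<in> \<Delta> - \<Delta>'}"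
    (is "_ = card ?M")
proof -
  let ?S = "stanley_reisner_ring V \<Delta> :: (('v \<Rightarrow>\<^sub>0 nat) \<Rightarrow>\<^sub>0 'k) set ring"
  interpret h: ring_hom_ring "poly_ring_on V" ?S "residue_class V \<Delta>"
    by (rule ring_hom_residue_class[OF \<Delta>])
  have "finite ?M"
    by (rule finite_subset[OF _ finite_monomials_of_degree[OF V, of k]]) auto
  then obtain us where us: "set us = ?M" "distinct us"
    using finite_distinct_list by blast
  let ?ms = "map (\<lambda>u. residue_class V \<Delta> (Poly_Mapping.single u 1)) us :: (('v \<Rightarrow>\<^sub>0 nat) \<Rightarrow>\<^sub>0 'k) set list"
  have ind: "h.S.independent (scalars V \<Delta>) ?ms"
    and span: "h.S.Span (scalars V \<Delta>) ?ms =
      relative_stanley_reisner_ideal V \<Delta> \<Delta>' \<inter> graded_component V \<Delta> k"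
    using monomials_independent[OF \<Delta> us(2), where ?'k = 'k] us(1)
    unfolding relative_graded_component_eq[OF \<Delta> \<Delta>'] us(1) by blast+
  have "h.S.dimension (length ?ms) (scalars V \<Delta>)
      (relative_stanley_reisner_ideal V \<Delta> \<Delta>' \<inter> graded_component V \<Delta> k)"
    using h.S.dimension_independent[OF ind] by (simp only: span)
  from h.S.dimI[OF subfield_scalars[OF \<Delta>] this]
  have "hilbert_function V \<Delta> (relative_stanley_reisner_ideal V \<Delta> \<Delta>' :: (_ \<Rightarrow>\<^sub>0 'k) set set) k = length us"
    by (simp add: hilbert_function_def over_def)
  also have "\<dots> = card ?M" using us by (metis distinct_card)
  finally show ?thesis .
qed

end

theory Submission
  imports Defs
begin

text \<open>
  A nowhere-zero flow modulo \<open>k\<close>, lifted to integers in \<open>{0<..<k}\<close>, is a lattice point in the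
  relative interior of the \<open>k\<close>-th dilate of one of the polytopes
  \<open>{x. divergence G x = b \<and> 0 \<le> x \<le> 1}\<close> with \<open>b\<close> integral. By total
  unimodularity every lattice point of the \<open>k\<close>-th dilate is a sum of \<open>k\<close> vertices, which
  are sets of arcs. Always subtracting the first possible vertex makes this sum canonical, and
  whether a sum is canonical depends only on the set of vertices that occur. These sets form a
  simplicial complex, namely a unimodular pulling triangulation of the polytopes. Flows thus
  correspond to monomials supported on its faces, and flows with a value \<open>0\<close> or \<open>k\<close> to
  monomials supported on its boundary.
\<close>

section \<open>Rounding fractional flows\<close>

text \<open>Signed incidence coefficients make linearity in \<open>f\<close> immediate and let a
  loop cancel itself. The values are integers for flows and reals for points of the
  polytopes.\<close>

definition divergence :: "('v, 'e) pre_digraph \<Rightarrow> ('e \<Rightarrow> 'a::comm_ring_1) \<Rightarrow> 'v \<Rightarrow> 'a" where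
  "divergence G f v = (\<Sum>e\<in>arcs G. (of_bool (head G e = v) - of_bool (tail G e = v)) * f e)"

lemma divergence_add: "divergence G (\<lambda>e. f e + g e) v = divergence G f v + divergence G g v"
  by (simp add: divergence_def distrib_left sum.distrib)

lemma divergence_cmult: "divergence G (\<lambda>e. c * f e) v = c * divergence G f v"
  by (simp add: divergence_def sum_distrib_left mult.left_commute)

lemma divergence_diff: "divergence G (\<lambda>e. f e - g e) v = divergence G f v - divergence G g v"
  by (simp add: divergence_def right_diff_distrib sum_subtractf)

lemma divergence_sum:
  "divergence G (\<lambda>e. \<Sum>i\<in>I. f i e) v = (\<Sum>i\<in>I. divergence G (f i) v)"
  unfolding divergence_def sum_distrib_left by (rule sum.swap)

lemma divergence_cong:
  "(\<And>e. e \<in> arcs G \<Longrightarrow> f e = g e) \<Longrightarrow> divergence G f v = divergence G g v"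
  by (simp add: divergence_def)

lemma divergence_of_int:
  "divergence G (\<lambda>e. of_int (f e)) v = of_int (divergence G f v)"
  by (simp add: divergence_def)

context fin_digraph
begin

lemma divergence_single:
  "e \<in> arcs G \<Longrightarrow>
    divergence G (\<lambda>a. of_bool (a = e)) v = of_bool (head G e = v) - of_bool (tail G e = v)"
  by (simp add: divergence_def sum.remove[of _ e])

lemma divergence_eq_in_out:
  "divergence G f v = (\<Sum>e\<in>in_arcs G v. f e) - (\<Sum>e\<in>out_arcs G v. f e)"
proof -
  have "divergence G f v =
      (\<Sum>e\<in>arcs G. if head G e = v then f e else 0) - (\<Sum>e\<in>arcs G. if tail G e = v then f e else 0)"
    unfolding divergence_def sum_subtractf[symmetric] by (intro sum.cong) auto
  then show ?thesis
    by (simp add: in_arcs_def out_arcs_def sum.inter_filter)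
qed

lemma divergence_outside: "v \<notin> verts G \<Longrightarrow> divergence G f v = 0"
  unfolding divergence_def by (intro sum.neutral) auto

text \<open>
  A cut meeting the fractional arcs in exactly one arc would have non-integral net flow, so the
  ends of every fractional arc are joined by a walk of other fractional arcs.
\<close>

lemma fractional_circulation:
  fixes x :: "'b \<Rightarrow> real"
  assumes int: "\<And>v. divergence G x v \<in> \<int>" and a: "a \<in> arcs G" "x a \<notin> \<int>"
  obtains c :: "'b \<Rightarrow> real" where
    "\<And>v. divergence G c v = 0" "c a = 1" "\<And>e. e \<in> arcs G \<Longrightarrow> x e \<in> \<int> \<Longrightarrow> c e = 0"
proof -
  define F where "F = {e \<in> arcs G. x e \<notin> \<int> \<and> e \<noteq> a}"
  define r where "r = (\<Union>e\<in>F. {(head G e, tail G e), (tail G e, head G e)})"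
  \<comment> \<open>A unit flow along an undirected walk from \<open>head G a\<close> to
    \<open>w\<close>; an arc traversed backwards counts with sign -1.\<close>
  have walk: "\<exists>c :: 'b \<Rightarrow> real. (\<forall>v. divergence G c v = of_bool (w = v) - of_bool (head G a = v)) \<and>
      (\<forall>e. e \<notin> F \<longrightarrow> c e = 0)" if "(head G a, w) \<in> r\<^sup>*" for w
    using that
  proof (induction rule: rtrancl_induct)
    case base
    show ?case by (intro exI[of _ "\<lambda>_. 0"]) (simp add: divergence_def)
  next
    case (step y z)
    then obtain c :: "'b \<Rightarrow> real" where c:
      "\<And>v. divergence G c v = of_bool (y = v) - of_bool (head G a = v)" "\<And>e. e \<notin> F \<Longrightarrow> c e = 0"
      by blast
    from step(2) obtain e where e: "e \<in> F"
      and "(y, z) = (head G e, tail G e) \<or> (y, z) = (tail G e, head G e)"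
      unfolding r_def by blast
    then consider "y = head G e" "z = tail G e" | "y = tail G e" "z = head G e" by blast
    then show ?case
    proof cases
      case 1
      with c e show ?thesis
        by (intro exI[of _ "\<lambda>b. c b - of_bool (b = e)"])
          (auto simp: divergence_diff divergence_single F_def)
    next
      case 2
      with c e show ?thesis
        by (intro exI[of _ "\<lambda>b. c b + of_bool (b = e)"])
          (auto simp: divergence_add divergence_single F_def)
    qed
  qed
  have "(head G a, tail G a) \<in> r\<^sup>*"
  proof (rule ccontr)
    assume cut: "(head G a, tail G a) \<notin> r\<^sup>*"
    define S where "S = {w \<in> verts G. (head G a, w) \<in> r\<^sup>*}"
    have S: "finite S" "head G a \<in> S" "tail G a \<notin> S"
      using a cut by (auto simp: S_def)
    have closed: "head G e \<in> S \<longleftrightarrow> tail G e \<in> S" if "e \<in> F" for e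
    proof -
      have "(head G e, tail G e) \<in> r" "(tail G e, head G e) \<in> r" using that by (auto simp: r_def)
      moreover have "e \<in> arcs G" using that by (simp add: F_def)
      ultimately show ?thesis by (auto simp: S_def intro: rtrancl_into_rtrancl)
    qed
    \<comment> \<open>Summing over \<open>S\<close> leaves only the arcs that cross its border:
      \<open>a\<close>, and others on which \<open>x\<close> is integral.\<close>
    have "(\<Sum>v\<in>S. divergence G x v) =
        (\<Sum>e\<in>arcs G. (of_bool (head G e \<in> S) - of_bool (tail G e \<in> S)) * x e)"
      unfolding divergence_def
      by (subst sum.swap) (simp add: sum_distrib_right[symmetric] sum_subtractf S(1) of_bool_def)
    also have "\<dots> = x a + (\<Sum>e\<in>arcs G - {a}. (of_bool (head G e \<in> S) - of_bool (tail G e \<in> S)) * x e)"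
      using a(1) S by (subst sum.remove[of _ a]) auto
    finally have "x a = (\<Sum>v\<in>S. divergence G x v) -
        (\<Sum>e\<in>arcs G - {a}. (of_bool (head G e \<in> S) - of_bool (tail G e \<in> S)) * x e)"
      by simp
    moreover have "(of_bool (head G e \<in> S) - of_bool (tail G e \<in> S)) * x e \<in> \<int>"
      if "e \<in> arcs G - {a}" for e
    proof (cases "e \<in> F")
      case True
      then show ?thesis using closed by simp
    next
      case False
      then have "x e \<in> \<int>" using that by (auto simp: F_def)
      then show ?thesis by (auto simp: of_bool_def)
    qed
    ultimately have "x a \<in> \<int>" using int by (auto intro!: Ints_diff Ints_sum)
    with a show False by simp
  qed
  from walk[OF this] obtain c :: "'b \<Rightarrow> real" where c:
    "\<And>v. divergence G c v = of_bool (tail G a = v) - of_bool (head G a = v)" "\<And>e. e \<notin> F \<Longrightarrow> c e = 0"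
    by blast
  \<comment> \<open>The arc \<open>a\<close> itself closes the walk from its head to its tail into a
    cycle.\<close>
  show thesis
  proof (rule that[of "\<lambda>e. c e + of_bool (e = a)"])
    show "divergence G (\<lambda>e. c e + of_bool (e = a)) v = 0" for v
      using c(1) a(1) by (simp add: divergence_add divergence_single)
    show "c a + of_bool (a = a) = 1"
      using c(2)[of a] by (simp add: F_def)
    show "c e + of_bool (e = a) = 0" if "e \<in> arcs G" "x e \<in> \<int>" for e
      using that c(2)[of e] a(2) by (auto simp: F_def)
  qed
qed

text \<open>Moving along a circulation on the fractional arcs until one of them reaches 0 or 1 keeps
  the divergence, leaves integral coordinates alone and lowers the number of fractional
  arcs.\<close>

lemma round_flow:
  fixes x :: "'b \<Rightarrow> real"
  assumes "\<And>e. e \<in> arcs G \<Longrightarrow> 0 \<le> x e \<and> x e \<le> 1" "\<And>v. divergence G x v \<in> \<int>"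
  shows "\<exists>T\<subseteq>arcs G. (\<forall>v. divergence G (\<lambda>e. of_bool (e \<in> T)) v = divergence G x v) \<and>
    (\<forall>e\<in>arcs G. x e \<in> \<int> \<longrightarrow> of_bool (e \<in> T) = x e)"
  using assms
proof (induction "card {e \<in> arcs G. x e \<notin> \<int>}" arbitrary: x rule: less_induct)
  case less
  show ?case
  proof (cases "\<forall>e\<in>arcs G. x e \<in> \<int>")
    case True
    have x01: "of_bool (e \<in> {e \<in> arcs G. x e = 1}) = x e" if "e \<in> arcs G" for e
    proof -
      from True that obtain n where "x e = of_int n" by (auto elim: Ints_cases)
      with less.prems(1)[OF that] that show ?thesis by auto
    qed
    show ?thesis
    proof (intro exI[of _ "{e \<in> arcs G. x e = 1}"] conjI allI ballI impI)
      show "divergence G (\<lambda>e. of_bool (e \<in> {e \<in> arcs G. x e = 1})) v = divergence G x v" for v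
        by (rule divergence_cong) (rule x01)
    qed (blast intro: x01)+
  next
    case False
    then obtain a where a: "a \<in> arcs G" "x a \<notin> \<int>" by blast
    from fractional_circulation[OF less.prems(2) a] obtain c :: "'b \<Rightarrow> real" where c:
      "\<And>v. divergence G c v = 0" "c a = 1" "\<And>e. e \<in> arcs G \<Longrightarrow> x e \<in> \<int> \<Longrightarrow> c e = 0" by blast
    \<comment> \<open>\<open>m e\<close> is the longest step along \<open>c\<close> that keeps
      \<open>x e\<close> in [0,1]. The minimum \<open>t\<close> is feasible for all arcs, and the
      arc \<open>b\<close> attaining it becomes integral.\<close>
    define m where "m e = (if c e > 0 then (1 - x e) / c e else x e / - c e)" for e
    define A where "A = {e \<in> arcs G. c e \<noteq> 0}"
    have A: "finite A" "A \<noteq> {}" using a c by (auto simp: A_def)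
    define t where "t = Min (m ` A)"
    obtain b where b: "b \<in> A" "t = m b"
      using Min_in[of "m ` A"] A unfolding t_def by blast
    have t_le: "t \<le> m e" if "e \<in> A" for e using that A by (simp add: t_def)
    have "0 \<le> t"
      unfolding b(2) m_def using b(1) less.prems(1)[of b] by (auto simp: A_def divide_simps)
    define y where "y e = x e + t * c e" for e
    have y01: "0 \<le> y e \<and> y e \<le> 1" if e: "e \<in> arcs G" for e
    proof -
      consider "c e = 0" | "c e > 0" | "c e < 0" by linarith
      then show ?thesis
      proof cases
        case 1
        then show ?thesis using less.prems(1)[OF e] by (simp add: y_def)
      next
        case 2
        then have "t * c e \<le> 1 - x e" "0 \<le> t * c e"
          using t_le[of e] e \<open>0 \<le> t\<close> by (auto simp: A_def m_def field_simps)
        then show ?thesis using less.prems(1)[OF e] by (simp add: y_def)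
      next
        case 3
        then have "- (t * c e) \<le> x e" "t * c e \<le> 0"
          using t_le[of e] e \<open>0 \<le> t\<close> by (auto simp: A_def m_def field_simps mult_nonneg_nonpos)
        then show ?thesis using less.prems(1)[OF e] by (simp add: y_def)
      qed
    qed
    have yx: "y e = x e" if "e \<in> arcs G" "x e \<in> \<int>" for e
      using c(3)[OF that] by (simp add: y_def)
    have "y b = 0 \<or> y b = 1"
      using b by (auto simp: y_def m_def A_def)
    then have "y b \<in> \<int>" by auto
    moreover have "b \<in> arcs G" "x b \<notin> \<int>" using b(1) c(3)[of b] by (auto simp: A_def)
    ultimately have "{e \<in> arcs G. y e \<notin> \<int>} \<subset> {e \<in> arcs G. x e \<notin> \<int>}"
      using yx by fastforce
    then have fewer: "card {e \<in> arcs G. y e \<notin> \<int>} < card {e \<in> arcs G. x e \<notin> \<int>}"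
      by (intro psubset_card_mono) auto
    have div: "divergence G y v = divergence G x v" for v
      unfolding y_def by (simp add: divergence_add divergence_cmult c(1))
    from less.hyps[OF fewer y01] less.prems(2)
    obtain T where "T \<subseteq> arcs G" "\<forall>v. divergence G (\<lambda>e. of_bool (e \<in> T)) v = divergence G x v"
      "\<forall>e\<in>arcs G. y e \<in> \<int> \<longrightarrow> of_bool (e \<in> T) = y e" unfolding div by blast
    then show ?thesis using yx by (intro exI[of _ T]) auto
  qed
qed

end


section \<open>A unimodular triangulation of the flow polytopes\<close>

text \<open>
  For an integral vector \<open>b\<close> the sets of arcs with divergence \<open>b\<close> are the lattice points of the
  polytope \<open>{x. divergence G x = b \<and> 0 \<le> x \<le> 1}\<close>, and the smallest face
  containing a set \<open>R\<close> of them consists of the sets between \<open>\<Inter>R\<close> and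
  \<open>\<Union>R\<close>. The standard faces below, restricted to one \<open>b\<close>, form the pulling triangulation
  for the order of the indices.
\<close>

locale arc_set_enumeration = fin_digraph G for G :: "('v, 'e) pre_digraph" +
  fixes N :: nat and T :: "nat \<Rightarrow> 'e set"
  assumes bij_T: "bij_betw T {..<N} (Pow (arcs G))"
begin

definition set_div :: "nat \<Rightarrow> 'v \<Rightarrow> int" where
  "set_div i v = divergence G (\<lambda>e. of_bool (e \<in> T i)) v"

text \<open>The polytopes for different \<open>b\<close> are triangulated side by side. A
  \<open>T j\<close> violating the last condition lies in the smallest polytope face containing
  \<open>R\<close>, and the greedy decomposition would prefer it to every member of
  \<open>R\<close>.\<close>

definition standard_faces :: "nat set set" where
  "standard_faces = {\<sigma>. \<sigma> \<subseteq> {..<N} \<and> (\<forall>i\<in>\<sigma>. \<forall>j\<in>\<sigma>. set_div i = set_div j) \<and>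
     (\<forall>R\<subseteq>\<sigma>. \<forall>j<N. R \<noteq> {} \<longrightarrow> (\<forall>r\<in>R. j < r \<and> set_div r = set_div j) \<longrightarrow>
        \<not> (\<Inter>(T ` R) \<subseteq> T j \<and> T j \<subseteq> \<Union>(T ` R)))}"

text \<open>If some arc lies in all sets of a nonempty face or in none, the face lies in a facet x e
  = 1 or x e = 0 of the cube. A polytope contained in such a facet counts as boundary
  altogether.\<close>

definition boundary_faces :: "nat set set" where
  "boundary_faces = {\<sigma>\<in>standard_faces. \<not> (\<Inter>(T ` \<sigma>) = {} \<and> \<Union>(T ` \<sigma>) = arcs G)}"

definition flow_of :: "(nat \<Rightarrow>\<^sub>0 nat) \<Rightarrow> 'e \<Rightarrow> nat" where
  "flow_of u e = (\<Sum>i\<in>Poly_Mapping.keys u. Poly_Mapping.lookup u i * of_bool (e \<in> T i))"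

section \<open>Standard and boundary faces as simplicial complexes\<close>

lemma T_subset: "i < N \<Longrightarrow> T i \<subseteq> arcs G"
  using bij_T by (auto simp: bij_betw_def)

lemma obtain_index:
  assumes "S \<subseteq> arcs G"
  obtains i where "i < N" "T i = S"
  using assms bij_T unfolding bij_betw_def by (metis PowI imageE lessThan_iff)

lemma standard_faces_down: "\<sigma> \<in> standard_faces \<Longrightarrow> \<tau> \<subseteq> \<sigma> \<Longrightarrow> \<tau> \<in> standard_faces"
  unfolding standard_faces_def mem_Collect_eq by (meson subset_iff)

lemma standard_facesD:
  assumes "\<sigma> \<in> standard_faces" "R \<subseteq> \<sigma>" "R \<noteq> {}" "j < N"
    and "\<And>r. r \<in> R \<Longrightarrow> j < r \<and> set_div r = set_div j"
    and "\<Inter>(T ` R) \<subseteq> T j" "T j \<subseteq> \<Union>(T ` R)"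
  shows False
  using assms unfolding standard_faces_def mem_Collect_eq by meson

lemma simplicial_complex_standard_faces: "simplicial_complex_on {..<N} standard_faces"
proof -
  have "{} \<in> standard_faces" by (simp add: standard_faces_def)
  moreover have "standard_faces \<subseteq> Pow {..<N}" by (auto simp: standard_faces_def)
  ultimately show ?thesis
    using standard_faces_down by (auto simp: simplicial_complex_on_def)
qed

text \<open>Passing to a subset enlarges the intersection and shrinks the union, which is bounded by
  \<open>arcs G\<close>; so neither equality can become newly true.\<close>

lemma simplicial_complex_boundary_faces: "simplicial_complex_on {..<N} boundary_faces"
proof -
  \<comment> \<open>The intersection over no sets is \<open>UNIV\<close>, so the empty face is a
    boundary face even for a graph without arcs.\<close>
  have "{} \<in> boundary_faces" by (simp add: boundary_faces_def standard_faces_def)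
  moreover have "boundary_faces \<subseteq> Pow {..<N}" by (auto simp: boundary_faces_def standard_faces_def)
  moreover have "\<tau> \<in> boundary_faces" if \<sigma>: "\<sigma> \<in> boundary_faces" and "\<tau> \<subseteq> \<sigma>" for \<sigma> \<tau>
  proof -
    have \<sigma>s: "\<sigma> \<in> standard_faces" using \<sigma> by (simp add: boundary_faces_def)
    then have upper: "\<Union>(T ` \<sigma>) \<subseteq> arcs G" using T_subset by (force simp: standard_faces_def)
    have "\<Inter>(T ` \<sigma>) \<subseteq> \<Inter>(T ` \<tau>)" "\<Union>(T ` \<tau>) \<subseteq> \<Union>(T ` \<sigma>)"
      using \<open>\<tau> \<subseteq> \<sigma>\<close> by (auto intro: INF_superset_mono)
    with \<sigma> upper have "\<not> (\<Inter>(T ` \<tau>) = {} \<and> \<Union>(T ` \<tau>) = arcs G)"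
      unfolding boundary_faces_def by (metis (mono_tags, lifting) mem_Collect_eq subset_antisym subset_empty)
    with standard_faces_down[OF \<sigma>s \<open>\<tau> \<subseteq> \<sigma>\<close>] show ?thesis
      unfolding boundary_faces_def mem_Collect_eq by (rule conjI)
  qed
  ultimately show ?thesis unfolding simplicial_complex_on_def by blast
qed

section \<open>Degree and flow of an exponent vector\<close>

lemma sum_keys_superset:
  "finite A \<Longrightarrow> Poly_Mapping.keys u \<subseteq> A \<Longrightarrow>
    (\<Sum>i\<in>Poly_Mapping.keys u. Poly_Mapping.lookup u i * w i) = (\<Sum>i\<in>A. Poly_Mapping.lookup u i * w i)"
  for w :: "nat \<Rightarrow> nat"
  by (intro sum.mono_neutral_left) (auto simp: in_keys_iff)

lemma exp_degree_superset:
  "finite A \<Longrightarrow> Poly_Mapping.keys u \<subseteq> A \<Longrightarrow> exp_degree u = (\<Sum>i\<in>A. Poly_Mapping.lookup u i)"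
  for u :: "nat \<Rightarrow>\<^sub>0 nat"
  using sum_keys_superset[of A u "\<lambda>_. 1"] by (simp add: exp_degree_def)

lemma exp_degree_add_single: "exp_degree (u + Poly_Mapping.single i 1) = Suc (exp_degree u)"
  for u :: "nat \<Rightarrow>\<^sub>0 nat"
proof -
  let ?A = "insert i (Poly_Mapping.keys u)"
  have "Poly_Mapping.keys (u + Poly_Mapping.single i 1) \<subseteq> ?A" by (simp add: keys_nat_add)
  then show ?thesis
    using exp_degree_superset[of ?A "u + Poly_Mapping.single i 1"] exp_degree_superset[of ?A u]
    by (simp add: lookup_add sum.distrib lookup_single when_def subset_insertI)
qed

lemma flow_of_add_single:
  "flow_of (u + Poly_Mapping.single i 1) e = flow_of u e + of_bool (e \<in> T i)"
proof -
  let ?A = "insert i (Poly_Mapping.keys u)"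
  have k: "Poly_Mapping.keys (u + Poly_Mapping.single i 1) \<subseteq> ?A" by (simp add: keys_nat_add)
  have "flow_of (u + Poly_Mapping.single i 1) e =
      (\<Sum>j\<in>?A. Poly_Mapping.lookup (u + Poly_Mapping.single i 1) j * of_bool (e \<in> T j))"
    unfolding flow_of_def by (rule sum_keys_superset) (use k in auto)
  also have "\<dots> = (\<Sum>j\<in>?A. Poly_Mapping.lookup u j * of_bool (e \<in> T j)) +
      (\<Sum>j\<in>?A. if j = i then of_bool (e \<in> T j) else 0)"
    unfolding sum.distrib[symmetric]
    by (intro sum.cong) (auto simp: lookup_add lookup_single when_def)
  also have "\<dots> = flow_of u e + of_bool (e \<in> T i)"
    unfolding flow_of_def by (subst sum_keys_superset[of ?A u]) auto
  finally show ?thesis .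
qed

text \<open>The excess of the degree over the flow counts the sets avoiding \<open>e\<close>, with
  multiplicity. This yields the bound on the flow and its extreme cases.\<close>

lemma exp_degree_split:
  "exp_degree u =
    flow_of u e + (\<Sum>i\<in>Poly_Mapping.keys u. Poly_Mapping.lookup u i * of_bool (e \<notin> T i))"
  unfolding flow_of_def exp_degree_def sum.distrib[symmetric] by (intro sum.cong) auto

lemma flow_of_le: "flow_of u e \<le> exp_degree u"
  using exp_degree_split[of u e] by simp

lemma flow_of_eq_0_iff: "flow_of u e = 0 \<longleftrightarrow> (\<forall>i\<in>Poly_Mapping.keys u. e \<notin> T i)"
  unfolding flow_of_def by (auto simp: in_keys_iff)

lemma flow_of_eq_degree_iff: "flow_of u e = exp_degree u \<longleftrightarrow> (\<forall>i\<in>Poly_Mapping.keys u. e \<in> T i)"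
  unfolding exp_degree_split[of u e] by (auto simp: in_keys_iff)

lemma divergence_flow_of:
  assumes "\<And>i. i \<in> Poly_Mapping.keys u \<Longrightarrow> set_div i v = b"
  shows "divergence G (\<lambda>e. int (flow_of u e)) v = int (exp_degree u) * b"
proof -
  have "divergence G (\<lambda>e. int (flow_of u e)) v =
      (\<Sum>i\<in>Poly_Mapping.keys u. int (Poly_Mapping.lookup u i) * set_div i v)"
    unfolding set_div_def divergence_cmult[symmetric] divergence_sum[symmetric]
    by (simp add: flow_of_def)
  also have "\<dots> = int (exp_degree u) * b"
    by (simp add: assms exp_degree_def sum_distrib_right)
  finally show ?thesis .
qed

section \<open>Uniqueness of standard decompositions\<close>

text \<open>Where \<open>u\<close> is first poorer than \<open>u'\<close>, its later sets must make
  up for the missing copies of \<open>T i\<close>. This forces \<open>T i\<close> between their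
  intersection and their union, against standardness of \<open>u\<close>.\<close>

lemma no_first_difference:
  assumes u: "Poly_Mapping.keys u \<in> standard_faces" and u': "Poly_Mapping.keys u' \<in> standard_faces"
    and deg: "exp_degree u = k" "exp_degree u' = k" "k > 0"
    and flow: "\<And>e. e \<in> arcs G \<Longrightarrow> flow_of u e = flow_of u' e"
    and before: "\<And>j. j < i \<Longrightarrow> Poly_Mapping.lookup u j = Poly_Mapping.lookup u' j"
  shows "\<not> Poly_Mapping.lookup u i < Poly_Mapping.lookup u' i"
proof
  assume less: "Poly_Mapping.lookup u i < Poly_Mapping.lookup u' i"
  have sub: "Poly_Mapping.keys u \<subseteq> {..<N}" "Poly_Mapping.keys u' \<subseteq> {..<N}"
    using u u' by (auto simp: standard_faces_def)
  have i: "i \<in> Poly_Mapping.keys u'" "i < N" using less sub(2) by (auto simp: in_keys_iff subset_iff)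
  define R where "R = {j \<in> Poly_Mapping.keys u. i < j}"
  \<comment> \<open>Each flow lies in the \<open>k\<close>-th dilate of the polytope of its sets. As
    the flows agree, cancelling \<open>k > 0\<close> shows that the polytope is the same.\<close>
  have divs: "set_div r = set_div i" if r: "r \<in> R" for r
  proof
    fix v
    have same: "set_div j = set_div r" if "j \<in> Poly_Mapping.keys u" for j
      using u r that unfolding standard_faces_def R_def by blast
    have same': "set_div j = set_div i" if "j \<in> Poly_Mapping.keys u'" for j
      using u' i that unfolding standard_faces_def by blast
    have "int k * set_div r v = divergence G (\<lambda>e. int (flow_of u e)) v"
      unfolding deg(1)[symmetric]
      by (rule divergence_flow_of[symmetric]) (simp add: same)
    also have "\<dots> = divergence G (\<lambda>e. int (flow_of u' e)) v"
      by (rule divergence_cong) (simp add: flow)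
    also have "\<dots> = int k * set_div i v"
      unfolding deg(2)[symmetric]
      by (rule divergence_flow_of) (simp add: same')
    finally show "set_div r v = set_div i v" using deg(3) by simp
  qed
  have split: "(\<Sum>j<N. g j) = (\<Sum>j<i. g j) + g i + (\<Sum>j\<in>{i<..<N}. g j)" for g :: "nat \<Rightarrow> nat"
  proof -
    have "{..<N} = insert i ({..<i} \<union> {i<..<N})" using i by auto
    then show ?thesis by (simp add: sum.union_disjoint[of "{..<i}" "{i<..<N}"] disjoint_iff)
  qed
  \<comment> \<open>The equal parts below \<open>i\<close> cancel, and the natural subtraction is
    exact by \<open>less\<close>. Weight 1 will give the degree, the indicator of an arc its
    flow.\<close>
  have tail: "(\<Sum>j\<in>{i<..<N}. Poly_Mapping.lookup u j * w j) =
      (Poly_Mapping.lookup u' i - Poly_Mapping.lookup u i) * w i +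
      (\<Sum>j\<in>{i<..<N}. Poly_Mapping.lookup u' j * w j)"
    if "(\<Sum>j\<in>Poly_Mapping.keys u. Poly_Mapping.lookup u j * w j) =
      (\<Sum>j\<in>Poly_Mapping.keys u'. Poly_Mapping.lookup u' j * w j)" for w :: "nat \<Rightarrow> nat"
  proof -
    have "(\<Sum>j<N. Poly_Mapping.lookup u j * w j) = (\<Sum>j<N. Poly_Mapping.lookup u' j * w j)"
      using that sub by (simp add: sum_keys_superset[of "{..<N}"])
    moreover have "(\<Sum>j<i. Poly_Mapping.lookup u j * w j) = (\<Sum>j<i. Poly_Mapping.lookup u' j * w j)"
      using before by simp
    moreover have "Poly_Mapping.lookup u i * w i \<le> Poly_Mapping.lookup u' i * w i"
      using less by simp
    ultimately show ?thesis unfolding split by (simp add: diff_mult_distrib)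
  qed
  have all: "(\<Sum>j\<in>{i<..<N}. Poly_Mapping.lookup u j) =
      (Poly_Mapping.lookup u' i - Poly_Mapping.lookup u i) + (\<Sum>j\<in>{i<..<N}. Poly_Mapping.lookup u' j)"
    using tail[of "\<lambda>_. 1"] deg by (simp add: exp_degree_def)
  have part: "(\<Sum>j\<in>{i<..<N}. Poly_Mapping.lookup u j * of_bool (e \<in> T j)) =
      (Poly_Mapping.lookup u' i - Poly_Mapping.lookup u i) * of_bool (e \<in> T i) +
      (\<Sum>j\<in>{i<..<N}. Poly_Mapping.lookup u' j * of_bool (e \<in> T j))" if "e \<in> arcs G" for e
    using flow[OF that] by (intro tail) (simp add: flow_of_def)
  have "(\<Sum>j\<in>{i<..<N}. Poly_Mapping.lookup u j) \<noteq> 0" using all less by simp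
  then have ne: "R \<noteq> {}" by (auto simp: R_def in_keys_iff)
  \<comment> \<open>An arc of \<open>T i\<close> has a positive term in \<open>part\<close>, which
    some set of \<open>R\<close> must supply.\<close>
  have upper: "T i \<subseteq> \<Union>(T ` R)"
  proof
    fix e assume e: "e \<in> T i"
    then have "(\<Sum>j\<in>{i<..<N}. Poly_Mapping.lookup u j * of_bool (e \<in> T j)) \<noteq> 0"
      using part[of e] T_subset[OF i(2)] less by (simp add: subset_iff del: sum_mult_of_bool_eq)
    then show "e \<in> \<Union>(T ` R)" by (auto simp: R_def in_keys_iff)
  qed
  \<comment> \<open>If all sets of \<open>R\<close> contained some \<open>e\<close> outside
    \<open>T i\<close>, the tail of \<open>u\<close> would carry its full weight through
    \<open>e\<close>, and the strictly lighter tail of \<open>u'\<close> could not match it.\<close>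
  have lower: "\<Inter>(T ` R) \<subseteq> T i"
  proof (rule ccontr)
    assume "\<not> \<Inter>(T ` R) \<subseteq> T i"
    then obtain e where e: "e \<in> \<Inter>(T ` R)" "e \<notin> T i" by blast
    then have "e \<in> arcs G" using ne sub T_subset by (fastforce simp: R_def)
    have "(\<Sum>j\<in>{i<..<N}. Poly_Mapping.lookup u j) =
        (\<Sum>j\<in>{i<..<N}. Poly_Mapping.lookup u j * of_bool (e \<in> T j))"
      using e by (intro sum.cong) (auto simp: R_def in_keys_iff)
    also have "\<dots> = (\<Sum>j\<in>{i<..<N}. Poly_Mapping.lookup u' j * of_bool (e \<in> T j))"
      using part[OF \<open>e \<in> arcs G\<close>] e(2) by simp
    also have "\<dots> \<le> (\<Sum>j\<in>{i<..<N}. Poly_Mapping.lookup u' j)"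
      by (intro sum_mono) simp
    finally show False using all less by simp
  qed
  have "R \<subseteq> Poly_Mapping.keys u" "\<And>r. r \<in> R \<Longrightarrow> i < r \<and> set_div r = set_div i"
    using divs by (auto simp: R_def)
  from standard_facesD[OF u this(1) ne i(2) this(2) lower upper] show False by simp
qed

text \<open>A smallest index of disagreement would contradict \<open>no_first_difference\<close> in
  one of its two directions.\<close>

lemma flow_of_inj:
  assumes "Poly_Mapping.keys u \<in> standard_faces" "Poly_Mapping.keys u' \<in> standard_faces"
    and "exp_degree u = k" "exp_degree u' = k" "k > 0"
    and "\<And>e. e \<in> arcs G \<Longrightarrow> flow_of u e = flow_of u' e"
  shows "u = u'"
proof (rule poly_mapping_eqI)
  fix i
  show "Poly_Mapping.lookup u i = Poly_Mapping.lookup u' i"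
  proof (induction i rule: less_induct)
    case (less i)
    then show ?case
      using no_first_difference[of u u' k i] no_first_difference[of u' u k i] assms
      by (metis linorder_neqE_nat)
  qed
qed

section \<open>Existence of standard decompositions\<close>

text \<open>Rounds \<open>f / k\<close>, a point of the unit cube with integral divergence
  \<open>b\<close>. Its coordinates 0 and 1 survive rounding, so subtracting \<open>T i\<close>
  leaves values between 0 and \<open>k - 1\<close>.\<close>

lemma subtractable_arc_set:
  assumes f: "\<And>e. e \<in> arcs G \<Longrightarrow> f e \<le> k" and "k > 0"
    and div: "\<And>v. divergence G (\<lambda>e. int (f e)) v = int k * b v"
  shows "\<exists>i<N. set_div i = b \<and> (\<forall>e\<in>arcs G. (f e = 0 \<longrightarrow> e \<notin> T i) \<and> (f e = k \<longrightarrow> e \<in> T i))"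
proof -
  have x: "divergence G (\<lambda>e. real (f e) / real k) v = of_int (b v)" for v
  proof -
    have "divergence G (\<lambda>e. real (f e) / real k) v = inverse (real k) * divergence G (\<lambda>e. of_int (int (f e))) v"
      unfolding divergence_cmult[symmetric] by (simp add: divide_inverse mult.commute)
    then show ?thesis using \<open>k > 0\<close> by (simp only: divergence_of_int div) simp
  qed
  have "\<exists>S\<subseteq>arcs G. (\<forall>v. divergence G (\<lambda>e. of_bool (e \<in> S)) v = divergence G (\<lambda>e. real (f e) / real k) v) \<and>
      (\<forall>e\<in>arcs G. real (f e) / real k \<in> \<int> \<longrightarrow> of_bool (e \<in> S) = real (f e) / real k)"
    using f \<open>k > 0\<close> by (intro round_flow) (auto simp: x)
  then obtain S where S: "S \<subseteq> arcs G" "\<And>v. divergence G (\<lambda>e. of_bool (e \<in> S)) v = real_of_int (b v)"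
    "\<And>e. e \<in> arcs G \<Longrightarrow> real (f e) / real k \<in> \<int> \<Longrightarrow> of_bool (e \<in> S) = real (f e) / real k"
    unfolding x by blast
  from S(1) obtain i where i: "i < N" "T i = S" by (rule obtain_index)
  have "set_div i v = b v" for v
  proof -
    have "real_of_int (set_div i v) = real_of_int (b v)"
      unfolding set_div_def divergence_of_int[symmetric] i(2) S(2)[symmetric] by simp
    then show ?thesis by simp
  qed
  moreover have "(f e = 0 \<longrightarrow> e \<notin> T i) \<and> (f e = k \<longrightarrow> e \<in> T i)" if "e \<in> arcs G" for e
    using S(3)[OF that] \<open>k > 0\<close> by (auto simp: i(2))
  ultimately show ?thesis using i(1) by blast
qed

text \<open>Greedy decomposition: the subtractable set of least index is removed and induction
  treats the rest. Carrying \<open>b\<close> through the induction keeps all chosen sets in one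
  polytope.\<close>

lemma flow_of_surj:
  assumes "\<And>e. e \<in> arcs G \<Longrightarrow> f e \<le> k"
    and "\<And>v. divergence G (\<lambda>e. int (f e)) v = int k * b v"
  shows "\<exists>u. exp_degree u = k \<and> Poly_Mapping.keys u \<in> standard_faces \<and>
    (\<forall>i\<in>Poly_Mapping.keys u. set_div i = b) \<and> (\<forall>e\<in>arcs G. flow_of u e = f e)"
  using assms
proof (induction k arbitrary: f)
  case 0
  then show ?case
    by (intro exI[of _ 0]) (simp add: exp_degree_def standard_faces_def flow_of_def)
next
  case (Suc k)
  define P where "P i \<longleftrightarrow> i < N \<and> set_div i = b \<and>
    (\<forall>e\<in>arcs G. (f e = 0 \<longrightarrow> e \<notin> T i) \<and> (f e = Suc k \<longrightarrow> e \<in> T i))" for i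
  define i where "i = (LEAST i. P i)"
  have "\<exists>i. P i" using subtractable_arc_set[OF Suc.prems(1) zero_less_Suc Suc.prems(2)] by (auto simp: P_def)
  then have P_i: "P i" unfolding i_def by (rule LeastI_ex)
  have least: "i \<le> j" if "P j" for j unfolding i_def using that by (rule Least_le)
  \<comment> \<open>On the arcs, \<open>P i\<close> makes the natural subtraction exact and brings
    all values down to at most \<open>k\<close>.\<close>
  define f' where "f' e = f e - of_bool (e \<in> T i)" for e
  have f: "f e = f' e + of_bool (e \<in> T i)" "f' e \<le> k" if "e \<in> arcs G" for e
    using P_i Suc.prems(1)[OF that] that by (auto simp: P_def f'_def le_Suc_eq)
  have "divergence G (\<lambda>e. int (f' e)) v = int k * b v" for v
  proof -
    have "divergence G (\<lambda>e. int (f e)) v = divergence G (\<lambda>e. int (f' e) + of_bool (e \<in> T i)) v"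
      by (rule divergence_cong) (simp add: f(1))
    then show ?thesis
      using P_i Suc.prems(2)[of v] by (simp add: divergence_add P_def flip: set_div_def) (simp add: algebra_simps)
  qed
  from Suc.IH[OF f(2) this] obtain u' where u': "exp_degree u' = k"
    "Poly_Mapping.keys u' \<in> standard_faces" "\<And>j. j \<in> Poly_Mapping.keys u' \<Longrightarrow> set_div j = b"
    "\<And>e. e \<in> arcs G \<Longrightarrow> flow_of u' e = f' e" by blast
  define u where "u = u' + Poly_Mapping.single i 1"
  have keys_u: "Poly_Mapping.keys u = insert i (Poly_Mapping.keys u')" by (simp add: u_def keys_nat_add)
  have deg: "exp_degree u = Suc k" using exp_degree_add_single u'(1) by (simp add: u_def)
  have flow: "flow_of u e = f e" if "e \<in> arcs G" for e
    using f(1)[OF that] u'(4)[OF that] flow_of_add_single by (simp add: u_def)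
  have sdiv: "set_div j = b" if "j \<in> Poly_Mapping.keys u" for j
    using that u'(3) P_i by (auto simp: keys_u P_def)
  have bound: "Poly_Mapping.keys u \<subseteq> {..<N}"
    using u'(2) P_i by (auto simp: keys_u P_def standard_faces_def)
  \<comment> \<open>A violating \<open>j\<close> satisfies \<open>P\<close>, since arcs with
    \<open>f e = 0\<close> lie in no set of \<open>u\<close> and those with
    \<open>f e = Suc k\<close> in all of them. So \<open>i \<le> j\<close>, hence \<open>i\<close>
    is not in \<open>R\<close>, and the violation already occurs in \<open>u'\<close>.\<close>
  have "\<not> (\<Inter>(T ` R) \<subseteq> T j \<and> T j \<subseteq> \<Union>(T ` R))"
    if R: "R \<subseteq> Poly_Mapping.keys u" "R \<noteq> {}" and j: "j < N" "\<forall>r\<in>R. j < r \<and> set_div r = set_div j" for R j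
  proof
    assume between: "\<Inter>(T ` R) \<subseteq> T j \<and> T j \<subseteq> \<Union>(T ` R)"
    have "P j"
      unfolding P_def
    proof (intro conjI ballI impI)
      show "set_div j = b" using R j(2) sdiv by fastforce
      show "e \<notin> T j" if "e \<in> arcs G" "f e = 0" for e
        using that flow[of e] flow_of_eq_0_iff[of u e] between R(1) by (simp add: subset_iff) blast
      show "e \<in> T j" if "e \<in> arcs G" "f e = Suc k" for e
        using that flow[of e] flow_of_eq_degree_iff[of u e] deg between R(1) by (simp add: subset_iff)
    qed (rule j(1))
    then have "i \<notin> R" using least[of j] j(2) by fastforce
    then have "R \<subseteq> Poly_Mapping.keys u'" using R(1) keys_u by (simp add: subset_insert)
    from standard_facesD[OF u'(2) this R(2) j(1)] j(2) between show False by blast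
  qed
  then have "Poly_Mapping.keys u \<in> standard_faces"
    using bound sdiv unfolding standard_faces_def by simp
  with deg flow sdiv show ?case by blast
qed

section \<open>Boundary faces and the count of nowhere-zero flows\<close>

text \<open>An arc has flow 0 when no set contains it, and flow equal to the degree when all do.
  Positive degree makes the support nonempty, so that the intersection is not
  \<open>UNIV\<close>.\<close>

lemma interior_iff:
  assumes "Poly_Mapping.keys u \<in> standard_faces" "exp_degree u > 0"
  shows "Poly_Mapping.keys u \<notin> boundary_faces \<longleftrightarrow>
    (\<forall>e\<in>arcs G. 0 < flow_of u e \<and> flow_of u e < exp_degree u)"
proof -
  let ?K = "Poly_Mapping.keys u"
  have ne: "?K \<noteq> {}" using assms(2) by (auto simp: exp_degree_def)
  have sub: "T i \<subseteq> arcs G" if "i \<in> ?K" for i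
    using assms(1) T_subset that unfolding standard_faces_def by blast
  have "\<Inter>(T ` ?K) = {} \<longleftrightarrow> (\<forall>e\<in>arcs G. \<not> (\<forall>i\<in>?K. e \<in> T i))"
    using ne sub by blast
  also have "\<dots> \<longleftrightarrow> (\<forall>e\<in>arcs G. flow_of u e < exp_degree u)"
    unfolding flow_of_eq_degree_iff[symmetric] using flow_of_le[of u] by (simp add: order_less_le)
  finally have upper: "\<Inter>(T ` ?K) = {} \<longleftrightarrow> (\<forall>e\<in>arcs G. flow_of u e < exp_degree u)" .
  have "\<Union>(T ` ?K) = arcs G \<longleftrightarrow> (\<forall>e\<in>arcs G. \<not> (\<forall>i\<in>?K. e \<notin> T i))"
    using sub by blast
  also have "\<dots> \<longleftrightarrow> (\<forall>e\<in>arcs G. 0 < flow_of u e)"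
    unfolding flow_of_eq_0_iff[symmetric] by simp
  finally show ?thesis
    using assms(1) upper by (auto simp: boundary_faces_def)
qed

text \<open>\<open>flow_of_surj\<close> asks for a condition at every \<open>v\<close> of the type;
  outside \<open>verts G\<close> the divergence is 0.\<close>

lemma modular_flow_iff:
  "modular_flow G k f \<longleftrightarrow> f \<in> arcs G \<rightarrow>\<^sub>E {0..<int k} \<and> (\<forall>v. int k dvd divergence G f v)"
  unfolding modular_flow_def divergence_eq_in_out[symmetric] cong_0_iff
  using divergence_outside by (metis dvd_0_right)

lemma modular_flow_count_eq:
  assumes "k > 0"
  shows "modular_flow_count G k = card {u \<in> monomials_on {..<N}. exp_degree u = k \<and>
    Poly_Mapping.keys u \<in> standard_faces - boundary_faces}" (is "_ = card ?M")
proof -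
  let ?F = "{f. modular_flow G k f \<and> nowhere_zero_on (arcs G) f}"
  \<comment> \<open>The value \<open>undefined\<close> outside \<open>arcs G\<close> matches the
    extensional functions in \<open>modular_flow\<close>, so that \<open>?g\<close> can be a
    bijection onto \<open>?F\<close>.\<close>
  let ?g = "\<lambda>u. \<lambda>e\<in>arcs G. int (flow_of u e)"
  have "?g u \<in> ?F" if u: "u \<in> ?M" for u
  proof -
    have pos: "\<And>e. e \<in> arcs G \<Longrightarrow> 0 < flow_of u e \<and> flow_of u e < k"
      using u interior_iff[of u] assms by auto
    have "Poly_Mapping.keys u \<noteq> {}" using u assms by (auto simp: exp_degree_def)
    then obtain i where "i \<in> Poly_Mapping.keys u" by blast
    then have same: "set_div j = set_div i" if "j \<in> Poly_Mapping.keys u" for j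
      using u that unfolding standard_faces_def by blast
    have "int k dvd divergence G (?g u) v" for v
    proof -
      have "divergence G (?g u) v = divergence G (\<lambda>e. int (flow_of u e)) v"
        by (rule divergence_cong) simp
      also have "\<dots> = int (exp_degree u) * set_div i v"
        by (rule divergence_flow_of) (simp add: same)
      finally show ?thesis using u by simp
    qed
    with pos show ?thesis by (auto simp: modular_flow_iff nowhere_zero_on_def)
  qed
  moreover have "\<exists>u\<in>?M. f = ?g u" if f: "f \<in> ?F" for f
  proof -
    have fE: "f \<in> arcs G \<rightarrow>\<^sub>E {0..<int k}" and "\<And>v. int k dvd divergence G f v"
      using f by (auto simp: modular_flow_iff)
    \<comment> \<open>The quotient of the divergence by \<open>k\<close> selects the polytope whose
      dilate contains \<open>f\<close>.\<close>
    then have b: "divergence G f v = int k * (divergence G f v div int k)" for v by simp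
    have nat_f: "int (nat (f e)) = f e" "0 < nat (f e)" "nat (f e) < k" if "e \<in> arcs G" for e
      using f fE that by (force simp: nowhere_zero_on_def dest: PiE_mem)+
    have "divergence G (\<lambda>e. int (nat (f e))) v = int k * (divergence G f v div int k)" for v
      unfolding b[of v, symmetric] by (rule divergence_cong) (rule nat_f(1))
    then have "\<exists>u. exp_degree u = k \<and> Poly_Mapping.keys u \<in> standard_faces \<and>
        (\<forall>i\<in>Poly_Mapping.keys u. set_div i = (\<lambda>v. divergence G f v div int k)) \<and>
        (\<forall>e\<in>arcs G. flow_of u e = nat (f e))"
      by (intro flow_of_surj) (simp_all add: nat_f(3) less_imp_le)
    then obtain u where u: "exp_degree u = k" "Poly_Mapping.keys u \<in> standard_faces"
      "\<And>e. e \<in> arcs G \<Longrightarrow> flow_of u e = nat (f e)"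
      by blast
    have "Poly_Mapping.keys u \<notin> boundary_faces"
      using interior_iff[of u] assms u nat_f(2,3) by simp
    moreover have "u \<in> monomials_on {..<N}"
      using u(2) unfolding monomials_on_def standard_faces_def by blast
    ultimately have "u \<in> ?M" using u by simp
    moreover have "f = ?g u"
    proof
      fix e
      show "f e = ?g u e"
        using u(3)[of e] nat_f(1)[of e] PiE_arb[OF fE, of e] by (cases "e \<in> arcs G") simp_all
    qed
    ultimately show ?thesis by blast
  qed
  moreover have "inj_on ?g ?M"
  proof (rule inj_onI)
    fix u u' assume *: "u \<in> ?M" "u' \<in> ?M" "?g u = ?g u'"
    have "flow_of u e = flow_of u' e" if "e \<in> arcs G" for e
      using fun_cong[OF *(3), of e] that by simp
    with * assms show "u = u'" by (intro flow_of_inj[of u u' k]) auto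
  qed
  ultimately have "bij_betw ?g ?M ?F" unfolding bij_betw_def by blast
  then show ?thesis
    by (simp add: modular_flow_count_def bij_betw_same_card)
qed

end

theorem theorem9:
  fixes G :: "('v, 'e) pre_digraph"
  assumes "fin_digraph G"
  shows "\<exists>(V' :: nat set) \<Delta> \<Delta>'.
           finite V' \<and> simplicial_complex_on V' \<Delta> \<and> simplicial_complex_on V' \<Delta>' \<and> \<Delta>' \<subseteq> \<Delta> \<and>
           (\<forall>k>0. modular_flow_count G k =
              hilbert_function V' \<Delta>
                (relative_stanley_reisner_ideal V' \<Delta> \<Delta>' :: ((nat \<Rightarrow>\<^sub>0 nat) \<Rightarrow>\<^sub>0 'k::field) set set) k)"
proof -
  interpret fin_digraph G by fact
  \<comment> \<open>The enumeration fixes the order in which vertices are pulled; any order will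
    do.\<close>
  obtain T where "bij_betw T {..<card (Pow (arcs G))} (Pow (arcs G))"
    using ex_bij_betw_nat_finite[of "Pow (arcs G)"] by (auto simp: atLeast0LessThan)
  then interpret arc_set_enumeration G "card (Pow (arcs G))" T
    by unfold_locales
  show ?thesis
  proof (intro exI conjI allI impI)
    show "boundary_faces \<subseteq> standard_faces" by (auto simp: boundary_faces_def)
    show "modular_flow_count G k = hilbert_function {..<card (Pow (arcs G))} standard_faces
        (relative_stanley_reisner_ideal {..<card (Pow (arcs G))} standard_faces boundary_faces ::
          ((nat \<Rightarrow>\<^sub>0 nat) \<Rightarrow>\<^sub>0 'k) set set) k" if "k > 0" for k
      unfolding modular_flow_count_eq[OF that]
      by (rule hilbert_function_eq_card_monomials[symmetric])
        (simp_all add: simplicial_complex_standard_faces simplicial_complex_boundary_faces)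
  qed (simp_all add: simplicial_complex_standard_faces simplicial_complex_boundary_faces)
qed

end
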